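(* Let $1<p,q<\infty$ with $\frac1p+\frac1q=1$, and let $\mu$ be a finite Borel measure on $\mathbb{R}^d$. Then every finite Borel measure $\nu$ on $\mathbb{R}^d$ is a $(p,q)$-Bessel measure for $\mu$.
   Context: For $t\in\mathbb{R}^d$ let $e_t(x)=e^{2\pi i t\cdot x}$. For a finite Borel measure $\mu$ on $\mathbb{R}^d$ and $1<p<\infty$, the compatible semi-inner product on $L^p(\mu)$ is $$[f,g]_{L^p(\mu)}=\frac{1}{\|g\|_{L^p(\mu)}^{p-2}}\int f(x)\,|g(x)|^{p-1}\,\overline{\mathrm{sgn}(g(x))}\,d\mu(x)$$ if $\|g\|_{L^p(\mu)}\neq0$, and $[f,g]_{L^p(\mu)}=0$ otherwise (where $\mathrm{sgn}(z)=z/|z|$ for $z\ne0$, $\mathrm{sgn}(0)=0$). For conjugate exponents $1<p,q<\infty$, a Borel measure $\nu$ on $\mathbb{R}^d$ is a $(p,q)$-Bessel measure for $\mu$ if there is a constant $B>0$ such that $\int_{\mathbb{R}^d}|[f,e_t]_{L^p(\mu)}|^q\,d\nu(t)\le B\|f\|_{L^p(\mu)}^q$ for every $f\in L^p(\mu)$. *)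

theory Defs
  imports "HOL-Analysis.Analysis"
begin

text \<open>
  Elements of \<open>L\<^sup>p(M)\<close> are represented by measurable functions rather than by their classes
  modulo almost everywhere equality; the norm and the semi-inner product below depend only
  on these classes.
\<close>

definition Lp_space :: "real \<Rightarrow> 'a measure \<Rightarrow> ('a \<Rightarrow> complex) set" where
  "Lp_space p M = {f \<in> borel_measurable M. integrable M (\<lambda>x. norm (f x) powr p)}"

definition Lp_norm :: "real \<Rightarrow> 'a measure \<Rightarrow> ('a \<Rightarrow> complex) \<Rightarrow> real" where
  "Lp_norm p M f = (LINT x|M. norm (f x) powr p) powr (1 / p)"

definition Lp_semi_inner ::
  "real \<Rightarrow> 'a measure \<Rightarrow> ('a \<Rightarrow> complex) \<Rightarrow> ('a \<Rightarrow> complex) \<Rightarrow> complex" where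
  "Lp_semi_inner p M f g =
     (if Lp_norm p M g \<noteq> 0
      then complex_of_real (1 / Lp_norm p M g powr (p - 2)) *
        (LINT x|M. f x * complex_of_real (norm (g x) powr (p - 1)) * cnj (sgn (g x)))
      else 0)"

definition expo :: "real ^ 'n \<Rightarrow> real ^ 'n \<Rightarrow> complex" where
  "expo t x = exp (2 * complex_of_real pi * \<i> * complex_of_real (t \<bullet> x))"

text \<open>
  The Bessel bound uses the extended nonnegative integral, so that it also asserts finiteness
  of the left-hand side; the Bochner integral would be \<open>0\<close> if that integral diverged.
\<close>

definition bessel_measure ::
  "real \<Rightarrow> real \<Rightarrow> (real ^ 'n) measure \<Rightarrow> (real ^ 'n) measure \<Rightarrow> bool" where
  "bessel_measure p q \<mu> \<nu> \<longleftrightarrow>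
     sets \<nu> = sets borel \<and>
     (\<exists>B>0. \<forall>f\<in>Lp_space p \<mu>.
        (\<integral>\<^sup>+t. ennreal (norm (Lp_semi_inner p \<mu> f (expo t)) powr q) \<partial>\<nu>)
          \<le> ennreal (B * Lp_norm p \<mu> f powr q))"

end

theory Submission
  imports Defs
begin

text \<open>
  A character has modulus one everywhere, so the integrand in \<open>[f, e\<^sub>t]\<close> has modulus \<open>\<bar>f\<bar>\<close>
  and the norm of \<open>e\<^sub>t\<close> depends only on the total mass \<open>m\<close> of \<open>\<mu>\<close>. The function
  \<open>t \<mapsto> [f, e\<^sub>t]\<close> is therefore bounded, uniformly in \<open>t\<close>, by a power of \<open>m\<close> times the
  \<open>L\<^sup>1\<close> norm of \<open>f\<close>. On a finite measure space the \<open>L\<^sup>1\<close> norm is controlled by the \<open>L\<^sup>p\<close> norm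
  (\<open>integral_norm_le_Lp_norm\<close>), and the powers of \<open>m\<close> combine to
  \<open>\<bar>[f, e\<^sub>t]\<bar> \<le> m\<^bsup>1/p\<^esup> \<parallel>f\<parallel>\<^sub>p\<close> (\<open>norm_Lp_semi_inner_unimodular_le\<close>). A function bounded in this way is
  \<open>q\<close>-integrable against every finite \<open>\<nu>\<close>, with Bessel bound \<open>\<nu>(\<real>\<^sup>d) m\<^bsup>q/p\<^esup>\<close>.
\<close>

text \<open>
  This is Hoelder's inequality against the constant function \<open>1\<close>. If \<open>f\<close> is nonzero, dividing it by the
  number \<open>s\<close> for which the mean of \<open>(\<bar>f\<bar> / s)\<^sup>p\<close> is \<open>1\<close> reduces it to integrating
  \<open>a \<le> a\<^sup>p / p + 1 / q\<close>, with \<open>q\<close> the conjugate exponent.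
\<close>

lemma (in finite_measure) integral_norm_le_Lp_norm:
  assumes p: "1 < p" and f: "f \<in> Lp_space p M"
  shows "(LINT x|M. norm (f x)) \<le> measure M (space M) powr (1 - 1 / p) * Lp_norm p M f"
proof -
  have fm [measurable]: "f \<in> borel_measurable M"
    and fi: "integrable M (\<lambda>x. norm (f x) powr p)"
    using f by (auto simp: Lp_space_def)
  define I where "I = (LINT x|M. norm (f x) powr p)"
  define m where "m = measure M (space M)"
  have I0: "0 \<le> I" by (simp add: I_def)
  have m0: "0 \<le> m" by (simp add: m_def)
  show ?thesis
  proof (cases "I = 0")
    case True
    then have "AE x in M. norm (f x) powr p = 0"
      using integral_nonneg_eq_0_iff_AE[OF fi] by (simp add: I_def)
    then have "AE x in M. norm (f x) = 0"
      by eventually_elim simp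
    then have "(LINT x|M. norm (f x)) = 0"
      by (rule integral_eq_zero_AE)
    then show ?thesis
      by (simp add: Lp_norm_def)
  next
    case False
    with I0 have Ipos: "0 < I" by simp
    have mpos: "0 < m"
    proof (rule ccontr)
      assume "\<not> 0 < m"
      then have "m = 0" using m0 by simp
      then have "emeasure M (space M) = 0"
        unfolding m_def by (simp add: emeasure_eq_measure)
      then have "AE x in M. False"
        by (simp add: AE_iff_measurable[where N = "space M"])
      then have "AE x in M. norm (f x) powr p = 0"
        by eventually_elim simp
      then have "I = 0"
        unfolding I_def by (rule integral_eq_zero_AE)
      with False show False by simp
    qed
    define s where "s = (I / m) powr (1 / p)"
    have spos: "0 < s" using Ipos mpos by (simp add: s_def)
    have sp: "s powr p = I / m"
      using p Ipos mpos by (simp add: s_def powr_powr)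
    define q where "q = 1 / (1 - 1 / p)"
    have q: "1 < q" "1 / p + 1 / q = 1"
      using p by (auto simp: q_def field_simps)
    define h where "h = (\<lambda>x. s * (norm (f x) powr p / s powr p / p + 1 / q))"
    have young: "norm (f x) \<le> h x" for x
    proof -
      have "norm (f x) / s * 1 \<le> (norm (f x) / s) powr p / p + 1 powr q / q"
        by (rule Youngs_inequality) (use p q spos in auto)
      also have "(norm (f x) / s) powr p = norm (f x) powr p / s powr p"
        using spos by (simp add: powr_divide)
      finally show ?thesis
        using spos by (simp add: h_def field_simps)
    qed
    have h0: "0 \<le> h x" for x
      using order_trans[OF norm_ge_zero young] .
    have hi: "integrable M h"
      unfolding h_def using fi by (intro integrable_mult_right integrable_add) auto
    have "(LINT x|M. norm (f x)) \<le> (LINT x|M. h x)"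
      by (rule integral_mono_AE') (use hi h0 young in auto)
    also have "(LINT x|M. h x) = s * (I / s powr p / p + m / q)"
      using fi by (simp add: h_def I_def m_def)
    also have "\<dots> = s * m * (1 / p + 1 / q)"
      using Ipos mpos by (simp add: sp field_simps)
    also have "\<dots> = m powr (1 - 1 / p) * I powr (1 / p)"
      using Ipos mpos by (simp add: q s_def powr_divide powr_diff)
    finally show ?thesis
      by (simp add: m_def I_def Lp_norm_def)
  qed
qed

lemma norm_expo [simp]: "norm (expo t x) = 1"
  by (simp add: expo_def norm_exp_eq_Re)

lemma (in finite_measure) Lp_norm_unimodular:
  assumes "\<And>x. norm (g x) = 1"
  shows "Lp_norm p M g = measure M (space M) powr (1 / p)"
  using assms by (simp add: Lp_norm_def)

text \<open>
  For every unimodular \<open>g\<close> this is the Cauchy--Schwarz inequality \<open>\<bar>[f, g]\<bar> \<le> \<parallel>f\<parallel> \<parallel>g\<parallel>\<close> of the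
  semi-inner product, with \<open>\<parallel>g\<parallel> = m\<^bsup>1/p\<^esup>\<close>; the exponent \<open>1/p\<close> is what remains of
  \<open>1 - 1/p\<close>, from the comparison of the norms of \<open>f\<close>, after the normalisation
  \<open>\<parallel>g\<parallel>\<^bsup>p-2\<^esup> = m\<^bsup>1-2/p\<^esup>\<close> has been divided out.
\<close>

lemma (in finite_measure) norm_Lp_semi_inner_unimodular_le:
  assumes p: "1 < p" and f: "f \<in> Lp_space p M" and g: "\<And>x. norm (g x) = 1"
  shows "norm (Lp_semi_inner p M f g) \<le> measure M (space M) powr (1 / p) * Lp_norm p M f"
proof (cases "measure M (space M) = 0")
  case True
  then show ?thesis
    by (simp add: Lp_semi_inner_def Lp_norm_unimodular[OF g])
next
  case False
  define m where "m = measure M (space M)"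
  have m: "0 < m"
    using False by (simp add: m_def zero_less_measure_iff)
  have g0: "g x \<noteq> 0" for x
    using g[of x] by auto
  have N: "Lp_norm p M g = m powr (1 / p)"
    by (simp add: m_def Lp_norm_unimodular[OF g])
  have "norm (LINT x|M. f x * complex_of_real (norm (g x) powr (p - 1)) * cnj (sgn (g x)))
      \<le> (LINT x|M. norm (f x * complex_of_real (norm (g x) powr (p - 1)) * cnj (sgn (g x))))"
    by (rule integral_norm_bound)
  also have "\<dots> = (LINT x|M. norm (f x))"
    by (intro Bochner_Integration.integral_cong) (simp_all add: norm_mult norm_sgn g g0)
  also have "\<dots> \<le> m powr (1 - 1 / p) * Lp_norm p M f"
    unfolding m_def by (rule integral_norm_le_Lp_norm[OF p f])
  finally have *: "norm (LINT x|M. f x * complex_of_real (norm (g x) powr (p - 1)) * cnj (sgn (g x)))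
      \<le> m powr (1 - 1 / p) * Lp_norm p M f" .
  have "norm (Lp_semi_inner p M f g) = inverse (m powr ((1 / p) * (p - 2))) *
      norm (LINT x|M. f x * complex_of_real (norm (g x) powr (p - 1)) * cnj (sgn (g x)))"
    using m by (simp add: Lp_semi_inner_def N norm_mult norm_divide powr_powr divide_inverse norm_inverse)
  also have "\<dots> \<le> inverse (m powr ((1 / p) * (p - 2))) * (m powr (1 - 1 / p) * Lp_norm p M f)"
    by (rule mult_left_mono[OF *]) simp
  also have "\<dots> = m powr (- ((1 / p) * (p - 2)) + (1 - 1 / p)) * Lp_norm p M f"
    by (simp only: powr_minus powr_add mult.assoc)
  also have "- ((1 / p) * (p - 2)) + (1 - 1 / p) = 1 / p"
    using p by (simp add: field_simps)
  finally show ?thesis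
    by (simp add: m_def)
qed

theorem proposition3p1:
  fixes p q :: real and \<mu> \<nu> :: "(real ^ 'n) measure"
  assumes "1 < p" and "1 < q" and "1 / p + 1 / q = 1"
    and "finite_measure \<mu>" and "sets \<mu> = sets borel"
    and "finite_measure \<nu>" and "sets \<nu> = sets borel"
  shows "bessel_measure p q \<mu> \<nu>"
proof -
  interpret M: finite_measure \<mu> by fact
  interpret N: finite_measure \<nu> by fact
  define m where "m = measure \<mu> (space \<mu>)"
  define n where "n = measure \<nu> (space \<nu>)"
  \<comment> \<open>The summand \<open>1\<close> keeps the Bessel constant positive when one of the measures is zero.\<close>
  define B where "B = m powr (q / p) * n + 1"
  have n0: "0 \<le> n" by (simp add: n_def)
  have "0 < B"
    using n0 by (simp add: B_def add_nonneg_pos)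
  moreover have "(\<integral>\<^sup>+t. ennreal (norm (Lp_semi_inner p \<mu> f (expo t)) powr q) \<partial>\<nu>)
      \<le> ennreal (B * Lp_norm p \<mu> f powr q)" if f: "f \<in> Lp_space p \<mu>" for f
  proof -
    define c where "c = (m powr (1 / p) * Lp_norm p \<mu> f) powr q"
    have c: "c = m powr (q / p) * Lp_norm p \<mu> f powr q"
      by (simp add: c_def powr_mult powr_powr Lp_norm_def)
    have "(\<integral>\<^sup>+t. ennreal (norm (Lp_semi_inner p \<mu> f (expo t)) powr q) \<partial>\<nu>)
        \<le> (\<integral>\<^sup>+t. ennreal c \<partial>\<nu>)"
      using assms(1,2) M.norm_Lp_semi_inner_unimodular_le[OF assms(1) f norm_expo]
      by (intro nn_integral_mono ennreal_leI) (auto simp: c_def m_def intro!: powr_mono2)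
    also have "\<dots> = ennreal (c * n)"
      using n0 by (simp add: n_def N.emeasure_eq_measure ennreal_mult c_def)
    also have "\<dots> \<le> ennreal (B * Lp_norm p \<mu> f powr q)"
      by (intro ennreal_leI) (simp add: c B_def algebra_simps)
    finally show ?thesis .
  qed
  ultimately show ?thesis
    unfolding bessel_measure_def using assms(7) by blast
qed

end
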